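(* Suppose that $f=h+\overline{g}$ is harmonic in the unit disk $\mathbb{D}$, where $h(z)=\sum_{n=0}^\infty a_nz^n$ and $g(z)=\sum_{n=1}^\infty b_nz^n$ are analytic in $\mathbb{D}$ (so $g(0)=0$), and that $\|f\|_{\mathcal{B}_H}\le1$, where $$\|f\|_{\mathcal{B}_H}=|f(0)|+\sup_{z\in\mathbb{D}}(1-|z|^2)\left(|h'(z)|+|g'(z)|\right).$$ Then $$|a_0|+\sum_{n=1}^\infty\sqrt{|a_n|^2+|b_n|^2}\,r^n\le1\quad\text{for } 0\le r\le R=0.55356.$$ The number $0.55356$ cannot be replaced by a number greater than $0.624162\ldots$; that is, for every $r<1$ greater than $0.624162\ldots$ there is such an $f$ for which the inequality fails at $r$.
   Context: $\mathbb{D}=\{z\in\mathbb{C}:|z|<1\}$. The quantity $\|\cdot\|_{\mathcal{B}_H}$ is the harmonic Bloch norm. *)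

theory Defs
  imports "HOL-Complex_Analysis.Complex_Analysis"
begin

text \<open>
  A harmonic function in the unit disk is presented by its canonical decomposition
  \<open>f = h + cnj g\<close> with \<open>h\<close>, \<open>g\<close> analytic and \<open>g 0 = 0\<close>, together with the Taylor
  coefficients \<open>a\<close> of \<open>h\<close> and \<open>b\<close> of \<open>g\<close>.  The value \<open>b 0\<close> is never used: the expansion of
  \<open>g\<close> starts at index 1, which forces \<open>g 0 = 0\<close>.  Nothing is required outside the disk.
\<close>

definition harmonic_expansion ::
  "(complex \<Rightarrow> complex) \<Rightarrow> (complex \<Rightarrow> complex) \<Rightarrow> (complex \<Rightarrow> complex) \<Rightarrow>
   (nat \<Rightarrow> complex) \<Rightarrow> (nat \<Rightarrow> complex) \<Rightarrow> bool"
  where "harmonic_expansion f h g a b \<longleftrightarrow>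
    h holomorphic_on ball 0 1 \<and> g holomorphic_on ball 0 1 \<and>
    (\<forall>z\<in>ball 0 1. f z = h z + cnj (g z)) \<and>
    (\<forall>z\<in>ball 0 1. (\<lambda>n. a n * z ^ n) sums h z) \<and>
    (\<forall>z\<in>ball 0 1. (\<lambda>n. b (Suc n) * z ^ Suc n) sums g z)"

text \<open>
  The supremum may be infinite, so the norm is valued in the extended non-negative reals.
  The function \<open>f\<close> determines \<open>h\<close> and \<open>g\<close> on the disk; they are passed explicitly because the
  norm is defined through their derivatives.
\<close>

definition harmonic_bloch_norm ::
  "(complex \<Rightarrow> complex) \<Rightarrow> (complex \<Rightarrow> complex) \<Rightarrow> (complex \<Rightarrow> complex) \<Rightarrow> ennreal"
  where "harmonic_bloch_norm f h g =
    ennreal (cmod (f 0)) +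
    (SUP z\<in>ball 0 1. ennreal ((1 - (cmod z)\<^sup>2) * (cmod (deriv h z) + cmod (deriv g z))))"

text \<open>The \<open>n\<close>-th entry is the summand of index \<open>n + 1\<close> of the Bohr-type sum.\<close>

definition bohr_term :: "(nat \<Rightarrow> complex) \<Rightarrow> (nat \<Rightarrow> complex) \<Rightarrow> real \<Rightarrow> nat \<Rightarrow> real"
  where "bohr_term a b r n =
    sqrt ((cmod (a (Suc n)))\<^sup>2 + (cmod (b (Suc n)))\<^sup>2) * r ^ Suc n"

end

theory Submission
  imports Defs
begin

text \<open>
  Write \<open>M = 1 - |a 0|\<close> and \<open>c n = sqrt (|a n|\<^sup>2 + |b n|\<^sup>2)\<close>. The norm hypothesis says
  \<open>|h'| + |g'| \<le> M / (1 - \<rho>\<^sup>2)\<close> on every circle \<open>|z| = \<rho>\<close>, hence \<open>|h'|\<^sup>2 + |g'|\<^sup>2\<close> is at most the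
  square of the right-hand side there. Averaging over the circle turns this into
  \<open>\<Sum> n\<^sup>2 (c n)\<^sup>2 \<rho>^(2n-2) \<le> (M / (1 - \<rho>\<^sup>2))\<^sup>2\<close>
  (\<open>mean_square_le_of_circle_bound\<close>), and a Bohr-type inequality should follow by Cauchy--Schwarz.
  Using all coefficients at once on one circle misses \<open>0.55356\<close> slightly, because equality in
  Cauchy--Schwarz would require \<open>c 1 > M\<close>. So two circles are used: \<open>\<rho> = 0\<close>, which gives
  \<open>c 1 \<le> M\<close>, and \<open>\<rho>\<^sup>2 = 2/5\<close>, where Cauchy--Schwarz is applied to the indices \<open>n \<ge> 2\<close> only. The
  remaining factor is a tail of the dilogarithm series, bounded in \<open>dilogarithm_tail_bound\<close>, and
  the sum is at most \<open>M\<close> for all \<open>r \<le> 5/9\<close>, which covers \<open>0.55356\<close>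
  (\<open>coefficient_sum_le\<close>, \<open>bohr_sum_le_1\<close>).

  For the other half, \<open>(3 sqrt 3 / 4) z\<^sup>2\<close> has Bloch seminorm 1, and the seminorm is invariant under
  composition with disk automorphisms. Composing with \<open>(z - a) / (1 - a z)\<close> and subtracting the
  constant term gives explicit Taylor coefficients. The sum of their moduli against \<open>r^n\<close>,
  maximised over \<open>a\<close>, first reaches 1 at about \<open>r = 0.6241617\<close>, with \<open>a\<close> about \<open>0.3775\<close>; taking
  \<open>a = 20/53\<close> gives a function whose sum already exceeds 1 at \<open>0.624162\<close>
  (\<open>mobius_square_partial_sum\<close>, \<open>bohr_sum_gt_1\<close>), and the sum increases with \<open>r\<close>.
\<close>

section \<open>Power series on the unit disk\<close>

lemma power_series_abs_summable:
  fixes c :: "nat \<Rightarrow> complex"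
  assumes "\<And>z. z \<in> ball 0 1 \<Longrightarrow> (\<lambda>n. c n * z ^ n) sums u z" and "0 \<le> \<rho>" "\<rho> < 1"
  shows "summable (\<lambda>n. cmod (c n) * \<rho> ^ n)"
proof -
  have "complex_of_real ((1 + \<rho>) / 2) \<in> ball 0 1"
    using assms(2,3) by (simp only: mem_ball_0 norm_of_real) simp
  then have "summable (\<lambda>n. c n * complex_of_real ((1 + \<rho>) / 2) ^ n)"
    using assms(1) sums_summable by blast
  then have "summable (\<lambda>n. norm (c n * complex_of_real \<rho> ^ n))"
    by (rule powser_insidea) (use assms(2,3) in \<open>simp only: norm_of_real; simp\<close>)
  then show ?thesis
    using assms(2) by (simp add: norm_mult norm_power)
qed

lemma power_series_deriv_sums:
  fixes c :: "nat \<Rightarrow> complex"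
  assumes u: "\<And>z. z \<in> ball 0 1 \<Longrightarrow> (\<lambda>n. c n * z ^ n) sums u z" and z: "z \<in> ball 0 1"
  shows "(\<lambda>n. diffs c n * z ^ n) sums deriv u z"
proof -
  have sm: "summable (\<lambda>n. c n * w ^ n)" if "norm w < 1" for w
    using u[of w] that by (auto simp: sums_iff)
  have "((\<lambda>w. \<Sum>n. c n * w ^ n) has_field_derivative (\<Sum>n. diffs c n * z ^ n)) (at z)"
    by (rule termdiffs_strong'[where K = 1]) (use sm z in auto)
  then have "(u has_field_derivative (\<Sum>n. diffs c n * z ^ n)) (at z)"
    by (rule has_field_derivative_transform_within_open[OF _ open_ball z])
      (use u in \<open>auto simp: sums_iff\<close>)
  then have "deriv u z = (\<Sum>n. diffs c n * z ^ n)"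
    by (rule DERIV_imp_deriv)
  moreover have "summable (\<lambda>n. diffs c n * z ^ n)"
    by (rule termdiff_converges[where K = 1]) (use sm z in auto)
  ultimately show ?thesis
    by (simp add: sums_iff)
qed

section \<open>Mean squares over circles\<close>

lemma sum_roots_of_unity_orthogonal:
  fixes k l N :: nat
  assumes "k < N" "l < N"
  shows "(\<Sum>j<N. cis (2 * pi * j / N) ^ k * cnj (cis (2 * pi * j / N) ^ l)) =
         (if k = l then of_nat N else 0)"
proof -
  define x where "x = cis (2 * pi * k / N) * cnj (cis (2 * pi * l / N))"
  have N: "N > 0" using assms by simp
  have "cis (2 * pi * j / N) ^ k * cnj (cis (2 * pi * j / N) ^ l) = x ^ j" for j
  proof -
    have "cis (2 * pi * j / N) ^ k = cis (2 * pi * k / N) ^ j" for k :: nat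
      unfolding Complex.DeMoivre by (rule arg_cong[where f = cis]) simp
    then show ?thesis by (simp add: x_def power_mult_distrib)
  qed
  then have S: "(\<Sum>j<N. cis (2 * pi * j / N) ^ k * cnj (cis (2 * pi * j / N) ^ l)) = (\<Sum>j<N. x ^ j)"
    by simp
  show ?thesis
  proof (cases "k = l")
    case True
    then show ?thesis unfolding S by (simp add: x_def cis_cnj cis_mult)
  next
    case False
    have "inj_on (\<lambda>k. cis (2 * pi * real k / real N)) {..<N}"
      using Complex.bij_betw_roots_unity[OF N] by (rule bij_betw_imp_inj_on)
    then have ne: "cis (2 * pi * k / N) \<noteq> cis (2 * pi * l / N)"
      using False assms by (auto simp: inj_on_def)
    have "x \<noteq> 1"
    proof
      assume "x = 1"
      then have "cis (2 * pi * l / N) = x * cis (2 * pi * l / N)" by simp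
      also have "\<dots> = cis (2 * pi * k / N)"
        by (simp add: x_def cis_cnj cis_mult)
      finally show False using ne by simp
    qed
    moreover have "x ^ N = 1"
    proof -
      have "cis (2 * pi * real m / real N) ^ N = 1" for m :: nat
        using N by (simp add: Complex.DeMoivre cis_multiple_2pi)
      then show ?thesis
        by (simp add: x_def power_mult_distrib flip: complex_cnj_power)
    qed
    ultimately have "(\<Sum>j<N. x ^ j) = 0"
      by (simp add: geometric_sum)
    then show ?thesis using False S by simp
  qed
qed

text \<open>
  Averaging over \<open>N\<close> equally spaced points is exact for the squared modulus of a polynomial of
  degree below \<open>N\<close>, by orthogonality of the characters of the cyclic group. This replaces
  Parseval's identity for the integral mean.
\<close>
lemma polynomial_mean_square:
  fixes c :: "nat \<Rightarrow> complex" and \<rho> :: real and N :: nat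
  shows "(\<Sum>j<N. (cmod (\<Sum>k<N. c k * (of_real \<rho> * cis (2 * pi * j / N)) ^ k))\<^sup>2) =
         N * (\<Sum>k<N. (cmod (c k))\<^sup>2 * \<rho> ^ (2 * k))"
proof -
  define d where "d k = c k * of_real \<rho> ^ k" for k
  define w where "w j = cis (2 * pi * real j / real N)" for j
  have "complex_of_real (\<Sum>j<N. (cmod (\<Sum>k<N. c k * (of_real \<rho> * w j) ^ k))\<^sup>2) =
        (\<Sum>j<N. (\<Sum>k<N. d k * w j ^ k) * cnj (\<Sum>l<N. d l * w j ^ l))"
    by (simp only: of_real_sum complex_norm_square d_def power_mult_distrib mult.assoc)
  also have "\<dots> = (\<Sum>j<N. \<Sum>k<N. \<Sum>l<N. d k * cnj (d l) * (w j ^ k * cnj (w j ^ l)))"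
    by (simp add: sum_product algebra_simps)
  also have "\<dots> = (\<Sum>k<N. \<Sum>l<N. \<Sum>j<N. d k * cnj (d l) * (w j ^ k * cnj (w j ^ l)))"
    by (subst sum.swap, rule sum.cong[OF refl], rule sum.swap)
  also have "\<dots> = (\<Sum>k<N. \<Sum>l<N. d k * cnj (d l) * (if k = l then of_nat N else 0))"
    unfolding sum_distrib_left[symmetric] w_def
    by (intro sum.cong refl) (simp only: sum_roots_of_unity_orthogonal lessThan_iff)
  also have "\<dots> = (\<Sum>k<N. d k * cnj (d k) * of_nat N)"
    by (intro sum.cong refl) (simp add: if_distrib cong: if_cong)
  also have "\<dots> = complex_of_real (N * (\<Sum>k<N. (cmod (c k))\<^sup>2 * \<rho> ^ (2 * k)))"
    unfolding of_real_mult of_real_sum complex_norm_square d_def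
    by (simp add: sum_distrib_left mult_2_right power_add mult_ac)
  finally show ?thesis
    unfolding w_def by (simp only: of_real_eq_iff)
qed

section \<open>The coefficient inequality\<close>

text \<open>
  From \<open>k = 5\<close> on, \<open>1 / k\<^sup>2 \<le> 1 / 25\<close> and the tail is dominated by a geometric series. The induction
  carries that geometric remainder, which leaves the three terms \<open>k = 2, 3, 4\<close> to be computed.
\<close>
lemma dilogarithm_tail_bound:
  shows "(\<Sum>k=2..<N. (125 / 162 :: real) ^ k / (real k)\<^sup>2) \<le> 5 / 18"
proof -
  define x :: real where "x = 125 / 162"
  have x1: "x \<noteq> 1" by (simp add: x_def)
  have step: "(\<Sum>k=2..<m + 5. x ^ k / (real k)\<^sup>2) + x ^ (m + 5) / (25 * (1 - x)) \<le> 5 / 18" for m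
  proof (induction m)
    case 0
    have "{2..<5::nat} = {2, 3, 4}" by auto
    then show ?case by (simp add: x_def power_divide)
  next
    case (Suc m)
    have "x ^ (m + 5) / (real (m + 5))\<^sup>2 \<le> x ^ (m + 5) / 25"
      using power_mono[of 5 "real (m + 5)" 2] by (intro divide_left_mono) (auto simp: x_def)
    also have "\<dots> = x ^ (m + 5) * (1 - x) / (25 * (1 - x))"
      using x1 unfolding x_def by simp
    also have "\<dots> = x ^ (m + 5) / (25 * (1 - x)) - x ^ (Suc m + 5) / (25 * (1 - x))"
      unfolding diff_divide_distrib[symmetric] by (simp add: algebra_simps flip: power_Suc)
    finally have "x ^ (m + 5) / (real (m + 5))\<^sup>2 \<le>
      x ^ (m + 5) / (25 * (1 - x)) - x ^ (Suc m + 5) / (25 * (1 - x))" .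
    moreover have "(\<Sum>k=2..<Suc m + 5. x ^ k / (real k)\<^sup>2) =
      (\<Sum>k=2..<m + 5. x ^ k / (real k)\<^sup>2) + x ^ (m + 5) / (real (m + 5))\<^sup>2"
      by (simp only: add_Suc sum.atLeastLessThan_Suc)
    ultimately show ?case using Suc by linarith
  qed
  have "(\<Sum>k=2..<N. x ^ k / (real k)\<^sup>2) \<le> (\<Sum>k=2..<N + 5. x ^ k / (real k)\<^sup>2)"
    by (intro sum_mono2) (auto simp: x_def)
  also have "\<dots> \<le> 5 / 18"
  proof -
    have "0 \<le> x ^ (N + 5) / (25 * (1 - x))" by (simp add: x_def)
    then show ?thesis using step[of N] by linarith
  qed
  finally show ?thesis unfolding x_def .
qed

text \<open>
  The bound \<open>B\<close> passes to the partial sums of degree below \<open>N\<close> up to the tail of the series, which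
  is uniformly small on the circle. The discrete Parseval identity applies to these partial sums,
  and the error disappears as \<open>N\<close> grows. The two squares add up to at most \<open>B\<^sup>2\<close> because
  \<open>x\<^sup>2 + y\<^sup>2 \<le> (x + y)\<^sup>2\<close> for nonnegative \<open>x\<close> and \<open>y\<close>.
\<close>
lemma mean_square_le_of_circle_bound:
  fixes c d :: "nat \<Rightarrow> complex" and K :: nat
  assumes p: "\<And>z. z \<in> ball 0 1 \<Longrightarrow> (\<lambda>n. c n * z ^ n) sums p z"
    and q: "\<And>z. z \<in> ball 0 1 \<Longrightarrow> (\<lambda>n. d n * z ^ n) sums q z"
    and \<rho>: "0 \<le> \<rho>" "\<rho> < 1"
    and B: "\<And>z. cmod z = \<rho> \<Longrightarrow> cmod (p z) + cmod (q z) \<le> B"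
  shows "(\<Sum>k<K. ((cmod (c k))\<^sup>2 + (cmod (d k))\<^sup>2) * \<rho> ^ (2 * k)) \<le> B\<^sup>2"
proof -
  define L where "L K = (\<Sum>k<K. ((cmod (c k))\<^sup>2 + (cmod (d k))\<^sup>2) * \<rho> ^ (2 * k))" for K :: nat
  define e where "e n = cmod (c n) * \<rho> ^ n + cmod (d n) * \<rho> ^ n" for n
  have sc: "summable (\<lambda>n. cmod (c n) * \<rho> ^ n)" and sd: "summable (\<lambda>n. cmod (d n) * \<rho> ^ n)"
    using power_series_abs_summable p q \<rho> by blast+
  have se: "summable e"
    unfolding e_def by (intro summable_add sc sd)
  have trunc: "cmod (\<Sum>k<N. f k * z ^ k) \<le> cmod (u z) + (\<Sum>k. cmod (f (k + N)) * \<rho> ^ (k + N))"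
    if "(\<lambda>n. f n * z ^ n) sums u z" "summable (\<lambda>n. cmod (f n) * \<rho> ^ n)" "cmod z = \<rho>"
    for f u z and N :: nat
  proof -
    have s: "summable (\<lambda>k. norm (f (k + N) * z ^ (k + N)))"
      using summable_ignore_initial_segment[OF that(2), of N] that(3)
      by (simp add: norm_mult norm_power)
    have "(\<lambda>k. f (k + N) * z ^ (k + N)) sums (u z - (\<Sum>k<N. f k * z ^ k))"
      using that(1) by (rule sums_split_initial_segment)
    then have "(\<Sum>k<N. f k * z ^ k) = u z - (\<Sum>k. f (k + N) * z ^ (k + N))"
      by (simp add: sums_iff)
    then have "cmod (\<Sum>k<N. f k * z ^ k) \<le> cmod (u z) + cmod (\<Sum>k. f (k + N) * z ^ (k + N))"
      by (simp add: norm_triangle_ineq4)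
    also have "cmod (\<Sum>k. f (k + N) * z ^ (k + N)) \<le> (\<Sum>k. cmod (f (k + N)) * \<rho> ^ (k + N))"
      using summable_norm[OF s] that(3) by (simp add: norm_mult norm_power)
    finally show ?thesis by simp
  qed
  have main: "L K \<le> (B + \<epsilon>)\<^sup>2" if \<epsilon>: "\<epsilon> > 0" for \<epsilon>
  proof -
    obtain N0 where N0: "\<And>n. n \<ge> N0 \<Longrightarrow> norm (\<Sum>i. e (i + n)) < \<epsilon>"
      using suminf_exist_split[OF \<epsilon> se] by blast
    define N where "N = max (max N0 K) 1"
    define z where "z j = of_real \<rho> * cis (2 * pi * real j / real N)" for j :: nat
    have N: "N \<ge> N0" "N \<ge> K" "N > 0" by (auto simp: N_def)
    have z: "cmod (z j) = \<rho>" "z j \<in> ball 0 1" for j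
      using \<rho> by (auto simp: z_def norm_mult)
    have tail: "(\<Sum>k. cmod (c (k + N)) * \<rho> ^ (k + N)) + (\<Sum>k. cmod (d (k + N)) * \<rho> ^ (k + N)) < \<epsilon>"
      using N0[OF N(1)] unfolding e_def
        suminf_add[OF summable_ignore_initial_segment[OF sc] summable_ignore_initial_segment[OF sd]]
      by simp
    have pt: "(cmod (\<Sum>k<N. c k * z j ^ k))\<^sup>2 + (cmod (\<Sum>k<N. d k * z j ^ k))\<^sup>2 \<le> (B + \<epsilon>)\<^sup>2" for j
    proof -
      let ?P = "cmod (\<Sum>k<N. c k * z j ^ k)" and ?Q = "cmod (\<Sum>k<N. d k * z j ^ k)"
      have "?P + ?Q \<le> B + \<epsilon>"
        using trunc[where u = p and z = "z j" and N = N, OF p[OF z(2)] sc z(1)]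
          trunc[where u = q and z = "z j" and N = N, OF q[OF z(2)] sd z(1)] tail B[OF z(1), of j]
        by linarith
      then have "(?P + ?Q)\<^sup>2 \<le> (B + \<epsilon>)\<^sup>2"
        by (intro power_mono) auto
      moreover have "?P\<^sup>2 + ?Q\<^sup>2 \<le> (?P + ?Q)\<^sup>2"
        by (simp add: power2_sum)
      ultimately show ?thesis by linarith
    qed
    have "real N * L N = (\<Sum>j<N. (cmod (\<Sum>k<N. c k * z j ^ k))\<^sup>2 + (cmod (\<Sum>k<N. d k * z j ^ k))\<^sup>2)"
      unfolding L_def z_def sum.distrib polynomial_mean_square distrib_right by (simp add: distrib_left)
    also have "\<dots> \<le> (\<Sum>j<N. (B + \<epsilon>)\<^sup>2)"
      by (intro sum_mono pt)
    finally have "L N \<le> (B + \<epsilon>)\<^sup>2"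
      using N(3) by simp
    moreover have "L K \<le> L N"
      unfolding L_def using N(2) \<rho> by (intro sum_mono2) auto
    ultimately show ?thesis by linarith
  qed
  have "((\<lambda>\<epsilon>. (B + \<epsilon>)\<^sup>2) \<longlongrightarrow> (B + 0)\<^sup>2) (at_right 0)"
    by (intro tendsto_intros)
  moreover have "\<forall>\<^sub>F \<epsilon> in at_right 0. L K \<le> (B + \<epsilon>)\<^sup>2"
    using main by (simp add: eventually_at_right_less eventually_at_filter)
  ultimately have "L K \<le> (B + 0)\<^sup>2"
    by (intro tendsto_lowerbound) auto
  then show ?thesis by (simp add: L_def)
qed

text \<open>
  Here \<open>c k\<close> stands for the coefficient of index \<open>k + 1\<close>, and \<open>5/3 = 1 / (1 - 2/5)\<close>. By
  Cauchy--Schwarz, the part \<open>S\<close> of the sum without its first term satisfies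
  \<open>9 S\<^sup>2 \<le> (25/9) M\<^sup>2 - (c 0)\<^sup>2\<close>, where \<open>2/5 * 5/18 = 1/9\<close> comes from the dilogarithm tail at
  \<open>(5/9)\<^sup>2 / (2/5) = 125/162\<close>. This forces \<open>S \<le> M - 5/9 * c 0\<close> as long as \<open>c 0 \<le> M\<close>, with equality
  of the two bounds at \<open>c 0 = M\<close>.
\<close>
lemma coefficient_sum_le:
  fixes c :: "nat \<Rightarrow> real" and N :: nat
  assumes c: "\<And>k. 0 \<le> c k"
    and c0: "c 0 \<le> M"
    and sq: "\<And>K. (\<Sum>k<K. (real (Suc k) * c k)\<^sup>2 * (2 / 5) ^ k) \<le> (5 / 3 * M)\<^sup>2"
  shows "(\<Sum>k<N. c k * (5 / 9) ^ Suc k) \<le> M"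
proof -
  define u where "u k = real (Suc k) * c k * sqrt (2 / 5) ^ k" for k
  define v where "v k = (5 / 9) ^ Suc k / (real (Suc k) * sqrt (2 / 5) ^ k)" for k
  define S where "S = (\<Sum>k=1..<N + 1. c k * (5 / 9) ^ Suc k)"
  have u2: "(u k)\<^sup>2 = (real (Suc k) * c k)\<^sup>2 * (2 / 5) ^ k" for k
    unfolding u_def power_mult_distrib power_even_eq[symmetric] power_mult[symmetric] mult.commute[of k 2]
    by (simp add: power_mult)
  have v2: "(v k)\<^sup>2 = 2 / 5 * ((125 / 162) ^ Suc k / (real (Suc k))\<^sup>2)" for k
  proof -
    have "(v k)\<^sup>2 = ((5 / 9)\<^sup>2) ^ Suc k / ((real (Suc k))\<^sup>2 * (2 / 5) ^ k)"
      unfolding v_def power_divide[of _ _ 2] power_mult_distrib power_mult[symmetric]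
        mult.commute[of k 2] mult.commute[of "Suc k" 2] by (simp add: power_mult power2_eq_square)
    also have "\<dots> = 2 / 5 * (((5 / 9)\<^sup>2 / (2 / 5)) ^ Suc k / (real (Suc k))\<^sup>2)"
      unfolding power_divide[of "(5 / 9)\<^sup>2"] by simp
    finally show ?thesis by (simp add: power2_eq_square)
  qed
  have M: "0 \<le> M" using c[of 0] c0 by simp
  have S: "S = (\<Sum>k=1..<N + 1. u k * v k)"
    unfolding S_def u_def v_def by (intro sum.cong) auto
  have U: "(\<Sum>k=1..<N + 1. (u k)\<^sup>2) \<le> (5 / 3 * M)\<^sup>2 - (c 0)\<^sup>2"
    using sq[of "N + 1"] unfolding u2 lessThan_atLeast0
    by (subst (asm) sum.atLeast_Suc_lessThan) auto
  have "(\<Sum>k=1..<N + 1. (v k)\<^sup>2) = 2 / 5 * (\<Sum>k=1..<N + 1. (125 / 162) ^ Suc k / (real (Suc k))\<^sup>2)"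
    by (simp only: v2 sum_distrib_left)
  also have "(\<Sum>k=1..<N + 1. (125 / 162) ^ Suc k / (real (Suc k))\<^sup>2) =
             (\<Sum>k=2..<N + 2. (125 / 162 :: real) ^ k / (real k)\<^sup>2)"
    using sum.shift_bounds_Suc_ivl[of "\<lambda>k. (125 / 162 :: real) ^ k / (real k)\<^sup>2" 1 "N + 1"]
    by (simp add: numeral_2_eq_2)
  finally have V: "(\<Sum>k=1..<N + 1. (v k)\<^sup>2) \<le> 1 / 9"
    using dilogarithm_tail_bound[of "N + 2"] by simp
  have "S\<^sup>2 \<le> (\<Sum>k=1..<N + 1. (u k)\<^sup>2) * (\<Sum>k=1..<N + 1. (v k)\<^sup>2)"
    unfolding S by (rule Cauchy_Schwarz_ineq_sum)
  also have "\<dots> \<le> ((5 / 3 * M)\<^sup>2 - (c 0)\<^sup>2) * (1 / 9)"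
    by (intro mult_mono U V sum_nonneg order_trans[OF sum_nonneg U]) auto
  also have "\<dots> \<le> (M - 5 / 9 * c 0)\<^sup>2"
  proof -
    \<comment> \<open>The product is 81 times the difference of the two sides.\<close>
    have "0 \<le> (M - c 0) * (56 * M - 34 * c 0)"
      using c0 M by (intro mult_nonneg_nonneg) auto
    then show ?thesis by (simp add: power2_eq_square algebra_simps)
  qed
  finally have "S \<le> M - 5 / 9 * c 0"
    by (rule power2_le_imp_le) (use c0 M in auto)
  moreover have "(\<Sum>k<N. c k * (5 / 9) ^ Suc k) \<le> (\<Sum>k<N + 1. c k * (5 / 9) ^ Suc k)"
    using c by (intro sum_mono2) auto
  moreover have "(\<Sum>k<N + 1. c k * (5 / 9) ^ Suc k) = c 0 * (5 / 9) + S"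
    unfolding S_def lessThan_atLeast0 by (subst sum.atLeast_Suc_lessThan) auto
  ultimately show ?thesis by simp
qed

section \<open>The Bohr inequality for harmonic Bloch functions\<close>

text \<open>
  As \<open>g\<close> has no constant term, its Taylor sequence is \<open>b\<close> with the entry at 0 set to 0.
\<close>
lemma harmonic_expansion_g_sums:
  assumes "harmonic_expansion f h g a b" "z \<in> ball 0 1"
  shows "(\<lambda>n. (b(0 := 0)) n * z ^ n) sums g z"
proof -
  have "(\<lambda>n. (b(0 := 0)) (Suc n) * z ^ Suc n) sums g z"
    using assms by (simp add: harmonic_expansion_def)
  then show ?thesis
    using sums_Suc[of "\<lambda>n. (b(0 := 0)) n * z ^ n" "g z"] by simp
qed

lemma harmonic_expansion_at_0:
  assumes "harmonic_expansion f h g a b"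
  shows "f 0 = a 0"
proof -
  have "(\<lambda>n. a n * 0 ^ n) sums h 0"
    using assms unfolding harmonic_expansion_def by (elim conjE) (erule bspec, simp)
  then have "h 0 = a 0"
    using powser_sums_zero[of a] by (rule sums_unique2)
  moreover have "(\<lambda>n. (b(0 := 0)) n * 0 ^ n) sums g 0"
    by (rule harmonic_expansion_g_sums[OF assms]) simp
  then have "g 0 = (b(0 := 0)) 0"
    using powser_sums_zero[of "b(0 := 0)"] by (rule sums_unique2)
  moreover have "f 0 = h 0 + cnj (g 0)"
    using assms by (simp add: harmonic_expansion_def)
  ultimately show ?thesis by simp
qed

lemma harmonic_bloch_norm_le_1_iff:
  "harmonic_bloch_norm f h g \<le> 1 \<longleftrightarrow>
    (\<forall>z\<in>ball 0 1. cmod (f 0) + (1 - (cmod z)\<^sup>2) * (cmod (deriv h z) + cmod (deriv g z)) \<le> 1)"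
proof -
  let ?D = "\<lambda>z. (1 - (cmod z)\<^sup>2) * (cmod (deriv h z) + cmod (deriv g z))"
  have D: "0 \<le> ?D z" if "z \<in> ball 0 1" for z
    using that by (simp add: abs_square_le_1)
  have "harmonic_bloch_norm f h g = (SUP z\<in>ball 0 1. ennreal (cmod (f 0)) + ennreal (?D z))"
    unfolding harmonic_bloch_norm_def by (rule ennreal_SUP_add_right) auto
  also have "\<dots> = (SUP z\<in>ball 0 1. ennreal (cmod (f 0) + ?D z))"
    using D by (intro SUP_cong refl ennreal_plus[symmetric]) auto
  finally show ?thesis
    by (simp add: SUP_le_iff)
qed

lemma bohr_term_summable:
  assumes "harmonic_expansion f h g a b" "0 \<le> r" "r < 1"
  shows "summable (bohr_term a b r)"
proof -
  have sa: "summable (\<lambda>n. cmod (a n) * r ^ n)"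
    using assms by (intro power_series_abs_summable[where u = h]) (auto simp: harmonic_expansion_def)
  have sb: "summable (\<lambda>n. cmod ((b(0 := 0)) n) * r ^ n)"
    using harmonic_expansion_g_sums[OF assms(1)] assms(2,3) by (rule power_series_abs_summable)
  have "summable (\<lambda>n. cmod (a (Suc n)) * r ^ Suc n + cmod ((b(0 := 0)) (Suc n)) * r ^ Suc n)"
    by (intro summable_add iffD2[OF summable_Suc_iff sa] iffD2[OF summable_Suc_iff sb])
  then show ?thesis
  proof (rule summable_comparison_test')
    fix n
    show "norm (bohr_term a b r n) \<le>
      cmod (a (Suc n)) * r ^ Suc n + cmod ((b(0 := 0)) (Suc n)) * r ^ Suc n"
      using assms(2) sqrt_sum_squares_le_sum_abs[of "cmod (a (Suc n))" "cmod (b (Suc n))"]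
      by (simp add: bohr_term_def distrib_right[symmetric] mult_right_mono)
  qed
qed

lemma bohr_sum_le_1:
  assumes e: "harmonic_expansion f h g a b" and n: "harmonic_bloch_norm f h g \<le> 1"
    and r: "0 \<le> r" "r \<le> 5 / 9"
  shows "cmod (a 0) + (\<Sum>n. bohr_term a b r n) \<le> 1"
proof -
  define M where "M = 1 - cmod (a 0)"
  define c where "c k = sqrt ((cmod (a (Suc k)))\<^sup>2 + (cmod (b (Suc k)))\<^sup>2)" for k
  have dh: "(\<lambda>n. diffs a n * z ^ n) sums deriv h z" if "z \<in> ball 0 1" for z
    using e that by (intro power_series_deriv_sums) (auto simp: harmonic_expansion_def)
  have dg: "(\<lambda>n. diffs (b(0 := 0)) n * z ^ n) sums deriv g z" if "z \<in> ball 0 1" for z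
    by (rule power_series_deriv_sums[OF harmonic_expansion_g_sums[OF e] that])
  have circle: "(\<Sum>k<K. (real (Suc k) * c k)\<^sup>2 * (\<rho>\<^sup>2) ^ k) \<le> (M / (1 - \<rho>\<^sup>2))\<^sup>2"
    if \<rho>: "0 \<le> \<rho>" "\<rho> < 1" for \<rho> and K :: nat
  proof -
    have "cmod (deriv h z) + cmod (deriv g z) \<le> M / (1 - \<rho>\<^sup>2)" if "cmod z = \<rho>" for z
    proof -
      have "1 - \<rho>\<^sup>2 > 0" using \<rho> by (simp add: abs_square_less_1)
      moreover have "(1 - \<rho>\<^sup>2) * (cmod (deriv h z) + cmod (deriv g z)) \<le> M"
      proof -
        have "z \<in> ball 0 1" using that \<rho> by simp
        then have "cmod (f 0) + (1 - (cmod z)\<^sup>2) * (cmod (deriv h z) + cmod (deriv g z)) \<le> 1"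
          using n unfolding harmonic_bloch_norm_le_1_iff by blast
        then show ?thesis
          by (simp add: M_def that harmonic_expansion_at_0[OF e])
      qed
      ultimately show ?thesis by (simp add: pos_le_divide_eq mult.commute)
    qed
    from mean_square_le_of_circle_bound[OF dh dg \<rho> this]
    have "(\<Sum>k<K. ((cmod (diffs a k))\<^sup>2 + (cmod (diffs (b(0 := 0)) k))\<^sup>2) * \<rho> ^ (2 * k)) \<le> (M / (1 - \<rho>\<^sup>2))\<^sup>2"
      by simp
    moreover have "(real (Suc k) * c k)\<^sup>2 * (\<rho>\<^sup>2) ^ k =
        ((cmod (diffs a k))\<^sup>2 + (cmod (diffs (b(0 := 0)) k))\<^sup>2) * \<rho> ^ (2 * k)" for k
      unfolding c_def diffs_def norm_mult power_mult_distrib norm_of_nat power_mult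
      by (simp add: distrib_left del: of_nat_Suc)
    ultimately show ?thesis by simp
  qed
  have "M \<ge> 0"
  proof -
    have "cmod (f 0) + (1 - (cmod 0)\<^sup>2) * (cmod (deriv h 0) + cmod (deriv g 0)) \<le> 1"
      using n centre_in_ball zero_less_one unfolding harmonic_bloch_norm_le_1_iff by blast
    moreover have "0 \<le> (1 - (cmod 0)\<^sup>2) * (cmod (deriv h 0) + cmod (deriv g 0))"
      by simp
    ultimately show ?thesis
      unfolding M_def harmonic_expansion_at_0[OF e] by linarith
  qed
  \<comment> \<open>The circle of radius 0 bounds the first coefficient, since \<open>0 ^ 0 = 1\<close>.\<close>
  then have "c 0 \<le> M"
    using circle[of 0 1] by (auto intro: power2_le_imp_le)
  moreover have "(\<Sum>k<K. (real (Suc k) * c k)\<^sup>2 * (2 / 5) ^ k) \<le> (5 / 3 * M)\<^sup>2" for K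
    using circle[of "sqrt (2 / 5)" K] by (simp add: mult.commute[of M])
  ultimately have le: "(\<Sum>k<N. c k * (5 / 9) ^ Suc k) \<le> M" for N
    by (intro coefficient_sum_le) (auto simp: c_def)
  have "(\<Sum>k<N. bohr_term a b r k) \<le> M" for N
  proof -
    have "(\<Sum>k<N. bohr_term a b r k) \<le> (\<Sum>k<N. c k * (5 / 9) ^ Suc k)"
      unfolding bohr_term_def c_def using r by (intro sum_mono mult_left_mono power_mono) auto
    then show ?thesis using le[of N] by linarith
  qed
  moreover have "summable (bohr_term a b r)"
    using r by (intro bohr_term_summable[OF e]) auto
  ultimately have "(\<Sum>n. bohr_term a b r n) \<le> M"
    by (intro suminf_le_const)
  then show ?thesis by (simp add: M_def)
qed

section \<open>The square of a disk automorphism as an extremal function\<close>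

text \<open>
  This identity expresses \<open>1 - |\<phi> z|\<^sup>2\<close> for the automorphism \<open>\<phi> z = (z - a) / (1 - a z)\<close>, and is
  behind the invariance \<open>(1 - |z|\<^sup>2) |\<phi>' z| = 1 - |\<phi> z|\<^sup>2\<close>.
\<close>
lemma mobius_norm_identity:
  fixes a :: real and z :: complex
  shows "(cmod (1 - a * z))\<^sup>2 - (cmod (z - a))\<^sup>2 = (1 - a\<^sup>2) * (1 - (cmod z)\<^sup>2)"
  unfolding cmod_power2 by (simp add: power2_eq_square algebra_simps)

text \<open>The maximum 1 is attained at \<open>x = 1 / sqrt 3\<close>, which explains the double root in the proof.\<close>
lemma cubic_le_1:
  fixes x :: real
  assumes "0 \<le> x"
  shows "3 * sqrt 3 / 2 * x * (1 - x\<^sup>2) \<le> 1"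
proof -
  have "0 \<le> (sqrt 3 * x - 1)\<^sup>2 * (sqrt 3 * x + 2)"
    using assms by simp
  also have "\<dots> = 2 - 3 * sqrt 3 * x * (1 - x\<^sup>2)"
    by (simp add: power2_eq_square algebra_simps)
  finally show ?thesis by simp
qed

definition mobius_square :: "real \<Rightarrow> complex \<Rightarrow> complex" where
  "mobius_square a z = of_real (3 * sqrt 3 / 4) * (((z - a) / (1 - a * z))\<^sup>2 - a\<^sup>2)"

definition mobius_square_coeff :: "real \<Rightarrow> nat \<Rightarrow> real" where
  "mobius_square_coeff a n =
     (if n = 0 then 0 else 3 * sqrt 3 / 4 * (1 - a\<^sup>2) * (n * (1 - a\<^sup>2) - 1 - a\<^sup>2) * a ^ n / a\<^sup>2)"

lemma mobius_denominator_nonzero: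
  fixes a :: real
  assumes "0 < a" "a < 1" "z \<in> ball 0 1"
  shows "1 - complex_of_real a * z \<noteq> 0" "norm (complex_of_real a * z) < 1"
proof -
  have "a * norm z < 1 * 1"
    using assms by (intro mult_strict_mono) auto
  then show *: "norm (complex_of_real a * z) < 1"
    using assms by (simp add: norm_mult)
  show "1 - complex_of_real a * z \<noteq> 0"
    using * by auto
qed

lemma mobius_square_has_derivative:
  assumes "0 < a" "a < 1" "z \<in> ball 0 1"
  shows "(mobius_square a has_field_derivative
     of_real (3 * sqrt 3 / 2) * ((z - a) / (1 - a * z)) * ((1 - a\<^sup>2) / (1 - a * z)\<^sup>2)) (at z)"
  unfolding mobius_square_def
  by (rule derivative_eq_intros refl mobius_denominator_nonzero assms)+
    (use mobius_denominator_nonzero[OF assms] in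
      \<open>simp add: power2_eq_square divide_simps; simp add: algebra_simps\<close>)

text \<open>
  With \<open>x = |\<phi> z|\<close>, invariance turns the left-hand side into the cubic for \<open>(3 sqrt 3 / 4) w\<^sup>2\<close> at
  \<open>|w| = x\<close>.
\<close>
lemma mobius_square_bloch:
  assumes "0 < a" "a < 1" "z \<in> ball 0 1"
  shows "(1 - (cmod z)\<^sup>2) * cmod (deriv (mobius_square a) z) \<le> 1"
proof -
  define d where "d = cmod (1 - a * z)"
  define x where "x = cmod (z - a) / d"
  have d: "d > 0" using mobius_denominator_nonzero[OF assms] by (simp add: d_def)
  have a: "1 - a\<^sup>2 > 0" using assms by (simp add: power_less_one_iff abs_square_less_1)
  have "1 - x\<^sup>2 = (d\<^sup>2 - (cmod (z - a))\<^sup>2) / d\<^sup>2"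
    using d by (simp add: x_def power_divide field_simps)
  then have x: "1 - x\<^sup>2 = (1 - a\<^sup>2) * (1 - (cmod z)\<^sup>2) / d\<^sup>2"
    unfolding d_def mobius_norm_identity .
  have "cmod (1 - (complex_of_real a)\<^sup>2) = 1 - a\<^sup>2"
    using a by (metis abs_of_pos norm_of_real of_real_1 of_real_diff of_real_power)
  then have "cmod (deriv (mobius_square a) z) = 3 * sqrt 3 / 2 * x * ((1 - a\<^sup>2) / d\<^sup>2)"
    unfolding DERIV_imp_deriv[OF mobius_square_has_derivative[OF assms]]
    by (simp only: norm_mult norm_divide norm_power x_def d_def) (simp add: norm_mult)
  then have "(1 - (cmod z)\<^sup>2) * cmod (deriv (mobius_square a) z) = 3 * sqrt 3 / 2 * x * (1 - x\<^sup>2)"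
    unfolding x by simp
  also have "\<dots> \<le> 1"
    using d by (intro cubic_le_1) (simp add: x_def)
  finally show ?thesis .
qed

text \<open>
  With \<open>w = a z\<close>, \<open>((z - a) / (1 - a z))\<^sup>2 - a\<^sup>2\<close> is \<open>(1 - a\<^sup>2) / a\<^sup>2\<close> times the combination
  \<open>(1 - a\<^sup>2) * w / (1 - w)\<^sup>2 - (1 + a\<^sup>2) * w / (1 - w)\<close> of the series \<open>\<Sum> n w^n\<close> and \<open>\<Sum> w^n\<close>, \<open>n \<ge> 1\<close>.
\<close>
lemma mobius_square_sums:
  assumes "0 < a" "a < 1" "z \<in> ball 0 1"
  shows "(\<lambda>n. of_real (mobius_square_coeff a n) * z ^ n) sums mobius_square a z"
proof -
  define w where "w = of_real a * z"
  define C :: complex where "C = of_real (3 * sqrt 3 / 4 * (1 - a\<^sup>2) / a\<^sup>2)"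
  have w: "1 - w \<noteq> 0" "norm w < 1"
    using mobius_denominator_nonzero[OF assms] by (auto simp: w_def)
  have "(\<lambda>n. C * ((1 - a\<^sup>2) * (w * (of_nat (Suc n) * w ^ n)) - (1 + a\<^sup>2) * (w * w ^ n))) sums
        (C * ((1 - a\<^sup>2) * (w * (1 / (1 - w)\<^sup>2)) - (1 + a\<^sup>2) * (w * (1 / (1 - w)))))"
    by (intro sums_mult sums_diff geometric_deriv_sums geometric_sums w)
  also have "(\<lambda>n. C * ((1 - a\<^sup>2) * (w * (of_nat (Suc n) * w ^ n)) - (1 + a\<^sup>2) * (w * w ^ n))) =
             (\<lambda>n. of_real (mobius_square_coeff a (Suc n)) * z ^ Suc n)"
    by (rule ext) (simp add: mobius_square_coeff_def C_def w_def power_mult_distrib, simp add: algebra_simps)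
  also have "C * ((1 - a\<^sup>2) * (w * (1 / (1 - w)\<^sup>2)) - (1 + a\<^sup>2) * (w * (1 / (1 - w)))) = mobius_square a z"
  proof -
    have z: "z = w / a" using assms by (simp add: w_def)
    have "complex_of_real a \<noteq> 0" using assms by simp
    then show ?thesis using w(1)
      unfolding mobius_square_def C_def z
      by (simp add: divide_simps) (simp add: algebra_simps power2_eq_square power4_eq_xxxx)
  qed
  finally have *: "(\<lambda>n. of_real (mobius_square_coeff a (Suc n)) * z ^ Suc n) sums mobius_square a z" .
  have "mobius_square_coeff a 0 = 0" by (simp add: mobius_square_coeff_def)
  then show ?thesis
    using sums_Suc[of "\<lambda>n. of_real (mobius_square_coeff a n) * z ^ n", OF *] by simp
qed

text \<open>
  The full series exceeds 1 by less than \<open>10^(-6)\<close>, so the numbers are tight: \<open>20/53\<close> is a simple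
  fraction close enough to the optimal parameter, 14 terms leave out less than \<open>10^(-7)\<close>, and
  \<open>sqrt 3\<close> is needed to five decimals.
\<close>
lemma mobius_square_partial_sum:
  "(\<Sum>n<14. \<bar>mobius_square_coeff (20 / 53) (Suc n)\<bar> * 0.624162 ^ Suc n) > 1"
proof -
  \<comment> \<open>For \<open>a = 20/53\<close>: \<open>1 - a\<^sup>2 = 2409/2809\<close>, \<open>1 + a\<^sup>2 = 3209/2809\<close> and \<open>(1 - a\<^sup>2) / a\<^sup>2 = 2409/400\<close>.\<close>
  define s where "s =
    (\<Sum>n<14. \<bar>(1 + real n) * (2409 / 2809) - 3209 / 2809\<bar> * (20 / 53 * 0.624162) ^ Suc n :: real)"
  have *: "s > 1 / (3 * 1.73205 / 4 * 2409 / 400)"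
    by (simp add: s_def lessThan_nat_numeral power_divide)
  moreover have "sqrt 3 \<ge> 1.73205"
    by (rule real_le_rsqrt) (simp add: power2_eq_square)
  ultimately have "1 < 3 * sqrt 3 / 4 * (2409 / 400) * s"
  proof -
    have "1 = 3 * 1.73205 / 4 * (2409 / 400) * (1 / (3 * 1.73205 / 4 * 2409 / 400) :: real)"
      by simp
    also have "\<dots> < 3 * 1.73205 / 4 * (2409 / 400) * s"
      using * by (intro mult_strict_left_mono) auto
    also have "\<dots> \<le> 3 * sqrt 3 / 4 * (2409 / 400) * s"
      using * \<open>sqrt 3 \<ge> 1.73205\<close> by (intro mult_right_mono) auto
    finally show ?thesis .
  qed
  also have "\<dots> = (\<Sum>n<14. \<bar>mobius_square_coeff (20 / 53) (Suc n)\<bar> * 0.624162 ^ Suc n)"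
    unfolding s_def sum_distrib_left mobius_square_coeff_def power_mult_distrib
    by (intro sum.cong refl) (simp add: abs_mult power2_eq_square)
  finally show ?thesis .
qed

lemma bohr_sum_gt_1:
  assumes r: "0.624162 < r" "r < 1"
  defines "h \<equiv> mobius_square (20 / 53)" and "a \<equiv> \<lambda>n. complex_of_real (mobius_square_coeff (20 / 53) n)"
  shows "harmonic_expansion h h (\<lambda>_. 0) a (\<lambda>_. 0)"
    and "harmonic_bloch_norm h h (\<lambda>_. 0) \<le> 1"
    and "cmod (a 0) + (\<Sum>n. bohr_term a (\<lambda>_. 0) r n) > 1"
proof -
  have "h holomorphic_on ball 0 1"
    unfolding h_def using mobius_square_has_derivative[of "20 / 53"]
    by (intro holomorphic_onI) (auto simp: field_differentiable_def intro: has_field_derivative_at_within)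
  moreover have "(\<lambda>n. a n * z ^ n) sums h z" if "z \<in> ball 0 1" for z
    unfolding h_def a_def using that by (intro mobius_square_sums) auto
  ultimately show e: "harmonic_expansion h h (\<lambda>_. 0) a (\<lambda>_. 0)"
    by (simp add: harmonic_expansion_def)
  show "harmonic_bloch_norm h h (\<lambda>_. 0) \<le> 1"
    unfolding harmonic_bloch_norm_le_1_iff
    using mobius_square_bloch[of "20 / 53"] by (simp add: h_def) (simp add: mobius_square_def)
  have "1 < (\<Sum>n<14. \<bar>mobius_square_coeff (20 / 53) (Suc n)\<bar> * 0.624162 ^ Suc n)"
    by (rule mobius_square_partial_sum)
  also have "\<dots> \<le> (\<Sum>n<14. bohr_term a (\<lambda>_. 0) r n)"
    unfolding bohr_term_def a_def using r
    by (simp del: power_Suc, intro sum_mono mult_left_mono power_mono) auto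
  also have "\<dots> \<le> (\<Sum>n. bohr_term a (\<lambda>_. 0) r n)"
    using r by (intro sum_le_suminf bohr_term_summable[OF e]) (auto simp: bohr_term_def)
  finally show "cmod (a 0) + (\<Sum>n. bohr_term a (\<lambda>_. 0) r n) > 1"
    by (simp add: a_def mobius_square_coeff_def)
qed

theorem theorem9:
  shows "(\<forall>f h g a b. harmonic_expansion f h g a b \<longrightarrow> harmonic_bloch_norm f h g \<le> 1 \<longrightarrow>
            (\<forall>r::real. 0 \<le> r \<longrightarrow> r \<le> 0.55356 \<longrightarrow>
               summable (bohr_term a b r) \<and> cmod (a 0) + (\<Sum>n. bohr_term a b r n) \<le> 1)) \<and>
         (\<forall>r::real. 0.624162 < r \<longrightarrow> r < 1 \<longrightarrow>
            (\<exists>f h g a b. harmonic_expansion f h g a b \<and> harmonic_bloch_norm f h g \<le> 1 \<and>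
               summable (bohr_term a b r) \<and> cmod (a 0) + (\<Sum>n. bohr_term a b r n) > 1))"
proof (intro conjI allI impI)
  fix f h g a b and r :: real
  assume *: "harmonic_expansion f h g a b" "harmonic_bloch_norm f h g \<le> 1" "0 \<le> r" "r \<le> 0.55356"
  show "summable (bohr_term a b r)"
    using * by (intro bohr_term_summable[OF *(1)]) auto
  show "cmod (a 0) + (\<Sum>n. bohr_term a b r n) \<le> 1"
    using * by (intro bohr_sum_le_1[OF *(1)]) auto
next
  fix r :: real
  assume r: "0.624162 < r" "r < 1"
  show "\<exists>f h g a b. harmonic_expansion f h g a b \<and> harmonic_bloch_norm f h g \<le> 1 \<and>
      summable (bohr_term a b r) \<and> cmod (a 0) + (\<Sum>n. bohr_term a b r n) > 1"
    using bohr_sum_gt_1[OF r] bohr_term_summable[OF bohr_sum_gt_1(1)[OF r], of r] r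
    by (intro exI conjI) auto
qed

end
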